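(* For any positive integers $a,b$, \[m(x^a-1,x^b-1)=\frac{\pi^2}{12}\,\frac{(a,b)^2}{ab}.\]
   Context: $(a,b)$ denotes the gcd. For nonzero $P_1,P_2\in\mathbb{C}[x]$, $m(P_1,P_2)=\int_0^1\log|P_1(e^{2\pi i\theta})|\log|P_2(e^{2\pi i\theta})|\,d\theta$. *)

theory Defs
  imports "HOL-Analysis.Analysis" "HOL-Computational_Algebra.Polynomial"
begin

text \<open>
  The multiple Mahler measure of two nonzero complex polynomials. The integrand is singular
  where one of the polynomials vanishes on the unit circle; there the library convention
  \<^term>\<open>ln 0 = (0::real)\<close> applies, on a finite set of \<open>\<theta>\<close>, which does not affect the integral.
\<close>

definition mahler2 :: "complex poly \<Rightarrow> complex poly \<Rightarrow> real" where
  "mahler2 P1 P2 =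
     (LINT \<theta>:{0..1}|lborel.
        ln (cmod (poly P1 (exp (2 * complex_of_real pi * \<i> * complex_of_real \<theta>)))) *
        ln (cmod (poly P2 (exp (2 * complex_of_real pi * \<i> * complex_of_real \<theta>)))))"

end

theory Submission
  imports Defs
begin

text \<open>
  For \<open>0 \<le> r < 1\<close> the function \<open>ln |1 - r e\<^sup>2\<^sup>\<pi>\<^sup>i\<^sup>k\<^sup>t|\<close> has the absolutely convergent cosine
  expansion \<open>- \<Sum>n. r\<^sup>n / n * cos (2 \<pi> k n t)\<close>. By orthogonality, only the terms with
  \<open>a n = b m\<close> survive in the integral of the product of the functions for \<open>k = a\<close> and \<open>k = b\<close>; these are
  \<open>n = b' j\<close>, \<open>m = a' j\<close> with \<open>a' = a / gcd a b\<close> and \<open>b' = b / gcd a b\<close>, which leaves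
  \<open>\<Sum>j. r ^ ((a' + b') j) / (2 a' b' j\<^sup>2)\<close>. As \<open>r \<rightarrow> 1\<close> this tends to the
  claimed value. For \<open>a = b\<close> these sums are bounded, so Fatou's lemma shows that the limit functions are
  square integrable, and this supplies the dominating function needed to pass to the limit in the integral.
\<close>

section \<open>The unit interval and the logarithm damped by a radius r\<close>

abbreviation unit_lborel :: "real measure" where
  "unit_lborel \<equiv> restrict_space lborel {0..1}"

text \<open>The radius r regularizes the logarithm: for 0 <= r < 1 the argument of \<open>ln\<close>
  stays away from 0. At r = 1 this is the factor in the Mahler measure, singular at t in (1/k) Z,
  where \<open>ln 0 = 0\<close> applies.\<close>

definition circle_log :: "real \<Rightarrow> nat \<Rightarrow> real \<Rightarrow> real" where
  "circle_log r k t = ln (cmod (1 - complex_of_real r * cis (2 * pi * real k * t)))"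

lemma finite_measure_unit_lborel: "finite_measure unit_lborel"
  by (rule finite_measureI) (simp add: emeasure_restrict_space space_restrict_space)

lemma borel_measurable_unit_lborel:
  assumes "f \<in> borel_measurable borel"
  shows "f \<in> borel_measurable unit_lborel"
  using assms by (intro measurable_restrict_space1) simp

lemma borel_measurable_circle_log [measurable]: "circle_log r k \<in> borel_measurable borel"
proof -
  have "(\<lambda>t. cmod (1 - complex_of_real r * cis (2 * pi * real k * t))) \<in> borel_measurable borel"
    by (intro borel_measurable_continuous_onI continuous_intros)
  then show ?thesis
    unfolding circle_log_def[abs_def] by measurable
qed

lemma integrable_unit_lborel_bounded:
  fixes f :: "real \<Rightarrow> real"
  assumes "f \<in> borel_measurable borel" and "\<And>t. \<bar>f t\<bar> \<le> B"
  shows "integrable unit_lborel f"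
  using assms
  by (intro finite_measure.integrable_const_bound[OF finite_measure_unit_lborel, of _ B]
        borel_measurable_unit_lborel) auto

section \<open>Cosine series and orthogonality\<close>

text \<open>Real part of the Taylor series of \<open>Ln (1 - w)\<close> at w = r \<open>cis\<close>
  (2 pi k t), where |w| = r < 1. Division by zero yields 0, so the term n = 0 vanishes here and in
  all series below.\<close>

lemma circle_log_sums:
  assumes "0 \<le> r" "r < 1"
  shows "(\<lambda>n. - (r ^ n / real n) * cos (2 * pi * real (k * n) * t)) sums circle_log r k t"
proof -
  define w where "w = complex_of_real r * cis (2 * pi * real k * t)"
  have w: "cmod (- w) < 1" using assms by (simp add: w_def norm_mult)
  then have "1 - w \<noteq> 0" by auto
  have "(\<lambda>n. - (w ^ n) / of_nat n) sums Ln (1 - w)"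
    using Ln_series'[OF w] by simp
  then have "(\<lambda>n. Re (- (w ^ n) / of_nat n)) sums Re (Ln (1 - w))"
    by (rule sums_Re)
  moreover have "Re (- (w ^ n) / of_nat n) = - (r ^ n / real n) * cos (2 * pi * real (k * n) * t)" for n
  proof -
    have "w ^ n = complex_of_real (r ^ n) * cis (2 * pi * real (k * n) * t)"
      by (simp add: w_def power_mult_distrib Complex.DeMoivre mult_ac)
    then show ?thesis by simp
  qed
  moreover have "Re (Ln (1 - w)) = circle_log r k t"
    using \<open>1 - w \<noteq> 0\<close> by (simp add: circle_log_def w_def)
  ultimately show ?thesis by (simp only:)
qed

lemma integral_cos_multiple:
  fixes k :: int
  shows "integral\<^sup>L unit_lborel (\<lambda>t. cos (2 * pi * of_int k * t)) = of_bool (k = 0)"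
proof (cases "k = 0")
  case True
  then show ?thesis by (simp add: measure_restrict_space space_restrict_space)
next
  case False
  define c where "c = 2 * pi * real_of_int k"
  have "c \<noteq> 0" using False by (simp add: c_def)
  have "(\<integral>t. cos (c * t) * indicator {0..1} t \<partial>lborel) = sin (c * 1) / c - sin (c * 0) / c"
    using \<open>c \<noteq> 0\<close>
    by (intro integral_FTC_Icc_real) (auto intro!: derivative_eq_intros)
  also have "\<dots> = 0"
    by (simp add: c_def)
  finally show ?thesis
    using False by (simp add: integral_restrict_space c_def mult_ac)
qed

text \<open>The product-to-sum formula leaves the frequencies m - n and m + n. Since n > 0 the
  second is never 0, so only the first can contribute, with weight 1/2. The difference is taken in
  \<open>int\<close> to cover m < n.\<close>

lemma integral_cos_mult_cos:
  fixes m n :: nat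
  assumes "n > 0"
  shows "integral\<^sup>L unit_lborel (\<lambda>t. cos (2 * pi * real m * t) * cos (2 * pi * real n * t))
    = of_bool (m = n) / 2"
proof -
  have "cos (2 * pi * real m * t) * cos (2 * pi * real n * t) =
     (cos (2 * pi * of_int (int m - int n) * t) + cos (2 * pi * of_int (int m + int n) * t)) / 2" for t
    by (simp add: cos_times_cos algebra_simps)
  moreover have "integrable unit_lborel (\<lambda>t. cos (2 * pi * of_int k * t))" for k :: int
    by (rule integrable_unit_lborel_bounded[of _ 1]) simp_all
  ultimately show ?thesis
    using assms
    by (simp only: integral_divide_zero Bochner_Integration.integral_add integral_cos_multiple) auto
qed

text \<open>Here 1 - r <= |1 - r z| <= 2 on the unit circle. The bound blows up as r tends to 1, so
  it serves only for fixed r.\<close>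

lemma circle_log_bounds:
  assumes "0 \<le> r" "r < 1"
  shows "\<bar>circle_log r k t\<bar> \<le> ln 2 - ln (1 - r)"
proof -
  define x where "x = cmod (1 - complex_of_real r * cis (2 * pi * real k * t))"
  have "1 - r \<le> x" "x \<le> 1 + r"
    using norm_triangle_ineq2[of 1 "complex_of_real r * cis (2 * pi * real k * t)"]
      norm_triangle_ineq4[of 1 "complex_of_real r * cis (2 * pi * real k * t)"] assms
    by (auto simp: x_def norm_mult)
  then have "ln (1 - r) \<le> ln x" "ln x \<le> ln 2"
    using assms by auto
  moreover have "ln (1 - r) \<le> 0" "0 \<le> ln (2::real)"
    using assms by auto
  ultimately show ?thesis unfolding circle_log_def x_def by linarith
qed

section \<open>Integrals of products for r < 1\<close>

text \<open>Termwise integration, justified by the geometric majorant r^n B. It is used twice: with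
  g a cosine, then with g a second damped logarithm.\<close>

lemma integral_circle_log_mult_sums:
  assumes r: "0 \<le> r" "r < 1" and [measurable]: "g \<in> borel_measurable borel"
    and g: "\<And>t. \<bar>g t\<bar> \<le> B"
  shows "(\<lambda>n. - (r ^ n / real n) * integral\<^sup>L unit_lborel (\<lambda>t. cos (2 * pi * real (k * n) * t) * g t))
    sums integral\<^sup>L unit_lborel (\<lambda>t. circle_log r k t * g t)"
proof -
  define F where "F n t = - (r ^ n / real n) * (cos (2 * pi * real (k * n) * t) * g t)" for n t
  have bound: "\<bar>F n t\<bar> \<le> r ^ n * B" for n t
  proof -
    have "r ^ n / real n \<le> r ^ n"
      using r by (cases "n = 0") (auto simp: divide_simps mult_le_cancel_left1)
    moreover have "\<bar>cos (2 * pi * real (k * n) * t)\<bar> * \<bar>g t\<bar> \<le> 1 * B"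
      using g by (intro mult_mono) auto
    ultimately have "(r ^ n / real n) * (\<bar>cos (2 * pi * real (k * n) * t)\<bar> * \<bar>g t\<bar>) \<le> r ^ n * (1 * B)"
      using r by (intro mult_mono[of _ "r ^ n"]) auto
    then show ?thesis using r by (simp add: F_def abs_mult)
  qed
  have summable: "summable (\<lambda>n. r ^ n * B)"
    using r by (intro summable_mult2 summable_geometric) auto
  have int: "integrable unit_lborel (F n)" for n
    by (rule integrable_unit_lborel_bounded[OF _ bound]) (simp add: F_def[abs_def])
  have "(\<lambda>n. integral\<^sup>L unit_lborel (F n)) sums (\<integral>t. (\<Sum>n. F n t) \<partial>unit_lborel)"
  proof (rule sums_integral[OF int])
    show "AE t in unit_lborel. summable (\<lambda>n. norm (F n t))"
      by (intro AE_I2 summable_comparison_test'[OF summable, of 0]) (simp add: bound)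
    have "(\<integral>t. norm (F n t) \<partial>unit_lborel) \<le> (\<integral>t. r ^ n * B \<partial>unit_lborel)" for n
      using bound int
      by (intro integral_mono integrable_norm finite_measure.integrable_const
          finite_measure_unit_lborel) auto
    then have "norm (\<integral>t. norm (F n t) \<partial>unit_lborel) \<le> r ^ n * B" for n
      by (simp add: measure_restrict_space space_restrict_space)
    then show "summable (\<lambda>n. \<integral>t. norm (F n t) \<partial>unit_lborel)"
      by (intro summable_comparison_test'[OF summable, of 0])
  qed
  moreover have "(\<Sum>n. F n t) = circle_log r k t * g t" for t
    using sums_mult2[OF circle_log_sums[OF r, of k t], of "g t"]
    by (simp add: F_def mult.assoc sums_iff)
  moreover have "integral\<^sup>L unit_lborel (F n) =
      - (r ^ n / real n) * integral\<^sup>L unit_lborel (\<lambda>t. cos (2 * pi * real (k * n) * t) * g t)" for n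
    unfolding F_def by (rule integral_mult_right_zero)
  ultimately show ?thesis by simp
qed

text \<open>By orthogonality only the term with k n = N survives, and it exists exactly when k
  divides N.\<close>

lemma integral_circle_log_mult_cos:
  assumes r: "0 \<le> r" "r < 1" and "k > 0" "N > 0"
  shows "integral\<^sup>L unit_lborel (\<lambda>t. circle_log r k t * cos (2 * pi * real N * t))
    = (if k dvd N then - (r ^ (N div k) / (2 * real (N div k))) else 0)"
proof -
  let ?I = "integral\<^sup>L unit_lborel (\<lambda>t. circle_log r k t * cos (2 * pi * real N * t))"
  have "(\<lambda>n. - (r ^ n / real n) * (of_bool (k * n = N) / 2)) sums ?I"
    using integral_circle_log_mult_sums[OF r, of "\<lambda>t. cos (2 * pi * real N * t)" 1 k]
    by (simp add: integral_cos_mult_cos[OF \<open>N > 0\<close>] del: of_nat_mult)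
  moreover have "(\<lambda>n. - (r ^ n / real n) * (of_bool (k * n = N) / 2)) sums
     (if k dvd N then - (r ^ (N div k) / (2 * real (N div k))) else 0)"
  proof (cases "k dvd N")
    case True
    have "(\<lambda>n. - (r ^ n / real n) * (of_bool (k * n = N) / 2)) =
       (\<lambda>n. if n = N div k then - (r ^ n / (2 * real n)) else 0)"
      using True \<open>k > 0\<close> by (auto simp: fun_eq_iff)
    then show ?thesis
      using sums_single[of "N div k" "\<lambda>n. - (r ^ n / (2 * real n))"] True by simp
  next
    case False
    then have "k * n \<noteq> N" for n by auto
    then show ?thesis using False by simp
  qed
  ultimately show ?thesis by (rule sums_unique2)
qed

lemma integral_circle_log_mult_circle_log_sums:
  assumes r: "0 \<le> r" "r < 1" and "a' > 0" "b' > 0" "g > 0" and coprime: "coprime a' b'"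
  shows "(\<lambda>j. (r ^ (a' + b')) ^ j / (real j)\<^sup>2 / (2 * real a' * real b')) sums
    integral\<^sup>L unit_lborel (\<lambda>t. circle_log r (g * a') t * circle_log r (g * b') t)"
proof -
  let ?I = "integral\<^sup>L unit_lborel (\<lambda>t. circle_log r (g * a') t * circle_log r (g * b') t)"
  \<comment> \<open>Term n of the first factor meets term m of the second when g a' n = g b' m. By
    coprimality this forces b' to divide n, and then m = a' n / b'.\<close>
  define c where "c n = (if b' dvd n then
    r ^ n / real n * (r ^ (a' * n div b') / (2 * real (a' * n div b'))) else 0)" for n
  have "- (r ^ n / real n) * integral\<^sup>L unit_lborel
      (\<lambda>t. cos (2 * pi * real (g * a' * n) * t) * circle_log r (g * b') t) = c n" for n
  \<comment> \<open>The cosine lemma needs positive frequency; for n = 0 both sides vanish because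
    of the division by zero.\<close>
  proof (cases "n = 0")
    case False
    then have "integral\<^sup>L unit_lborel
      (\<lambda>t. cos (2 * pi * real (g * a' * n) * t) * circle_log r (g * b') t) =
      (if g * b' dvd g * a' * n then
        - (r ^ (g * a' * n div (g * b')) / (2 * real (g * a' * n div (g * b')))) else 0)"
      using integral_circle_log_mult_cos[OF r, of "g * b'" "g * a' * n"] assms
      by (simp add: mult.commute[of "cos _"] del: of_nat_mult)
    moreover have "g * b' dvd g * a' * n \<longleftrightarrow> b' dvd n"
      using \<open>g > 0\<close> coprime by (simp add: mult.assoc coprime_commute coprime_dvd_mult_right_iff)
    moreover have "g * a' * n div (g * b') = a' * n div b'"
      using \<open>g > 0\<close> by (simp add: mult.assoc)
    ultimately show ?thesis by (simp add: c_def)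
  qed (simp add: c_def)
  then have "c sums ?I"
    using integral_circle_log_mult_sums[OF r borel_measurable_circle_log circle_log_bounds[OF r],
        of "g * a'" "g * b'"] by simp
  \<comment> \<open>Only n = b' j contributes, so the sum is reindexed by j; then m = a' j, and the
    powers of r combine to exponent (a' + b') j.\<close>
  moreover have "strict_mono (\<lambda>j. b' * j)"
    using \<open>b' > 0\<close> by (auto simp: strict_mono_def)
  moreover have "c n = 0" if "n \<notin> range (\<lambda>j. b' * j)" for n
    using that by (auto simp: c_def dvd_def)
  ultimately have "(\<lambda>j. c (b' * j)) sums ?I"
    using sums_mono_reindex[of "\<lambda>j. b' * j" c] by blast
  moreover have "c (b' * j) = (r ^ (a' + b')) ^ j / (real j)\<^sup>2 / (2 * real a' * real b')" for j
  proof -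
    have "a' * (b' * j) div b' = a' * j"
      using \<open>b' > 0\<close> by (simp add: mult.left_commute)
    then show ?thesis
      by (simp add: c_def power_add power_mult power_mult_distrib power2_eq_square mult_ac)
  qed
  ultimately show ?thesis by simp
qed

section \<open>The limit of these integrals as r tends to 1\<close>

lemma sums_inverse_squares_nat: "(\<lambda>j. 1 / (real j)\<^sup>2) sums (pi\<^sup>2 / 6)"
  using inverse_squares_sums sums_Suc_iff[of "\<lambda>j. 1 / (real j)\<^sup>2" "pi\<^sup>2 / 6"] by simp

text \<open>Dominated convergence for series (Tannery) with majorant 1/j^2, whose sum is the Basel
  value.\<close>

lemma tendsto_suminf_power_div_square:
  assumes "\<And>i. 0 \<le> x i" "\<And>i. x i \<le> 1" and x: "x \<longlonglongrightarrow> 1"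
  shows "(\<lambda>i. \<Sum>j. x i ^ j / (real j)\<^sup>2) \<longlonglongrightarrow> pi\<^sup>2 / 6"
proof -
  have "(\<lambda>i. \<Sum>j. x i ^ j / (real j)\<^sup>2) \<longlonglongrightarrow> (\<Sum>j. 1 ^ j / (real j)\<^sup>2)"
  proof (rule tannerys_theorem[THEN conjunct2, THEN conjunct2])
    show "(\<lambda>i. x i ^ j / (real j)\<^sup>2) \<longlonglongrightarrow> 1 ^ j / (real j)\<^sup>2" for j
      unfolding divide_inverse by (intro tendsto_intros x)
    show "\<forall>\<^sub>F (j, i) in sequentially \<times>\<^sub>F sequentially. norm (x i ^ j / (real j)\<^sup>2) \<le> 1 / (real j)\<^sup>2"
      using assms by (intro always_eventually) (auto intro!: divide_right_mono power_le_one)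
    show "summable (\<lambda>j. 1 / (real j)\<^sup>2)"
      using sums_inverse_squares_nat by (rule sums_summable)
  qed simp
  then show ?thesis using sums_unique[OF sums_inverse_squares_nat] by simp
qed

lemma tendsto_integral_circle_log_mult_circle_log:
  assumes "a > 0" "b > 0" and r: "\<And>i. 0 \<le> r i" "\<And>i. r i < 1" "r \<longlonglongrightarrow> 1"
  shows "(\<lambda>i. integral\<^sup>L unit_lborel (\<lambda>t. circle_log (r i) a t * circle_log (r i) b t))
    \<longlonglongrightarrow> pi\<^sup>2 / 12 * ((real (gcd a b))\<^sup>2 / (real a * real b))"
proof -
  define g where "g = gcd a b"
  obtain a' b' where ab: "a = g * a'" "b = g * b'" "coprime a' b'"
    using gcd_coprime_exists[of a b] assms unfolding g_def by (auto simp: mult.commute)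
  have pos: "g > 0" "a' > 0" "b' > 0" using assms ab by auto
  have "(\<lambda>i. (\<Sum>j. (r i ^ (a' + b')) ^ j / (real j)\<^sup>2) / (2 * real a' * real b'))
     \<longlonglongrightarrow> pi\<^sup>2 / 6 / (2 * real a' * real b')"
    using r(1) less_imp_le[OF r(2)] pos tendsto_power[OF r(3), of "a' + b'"]
    by (intro tendsto_divide tendsto_const tendsto_suminf_power_div_square) (auto intro!: power_le_one)
  moreover have "(\<Sum>j. (r i ^ (a' + b')) ^ j / (real j)\<^sup>2) / (2 * real a' * real b') =
      integral\<^sup>L unit_lborel (\<lambda>t. circle_log (r i) a t * circle_log (r i) b t)" for i
  proof -
    have sums: "(\<lambda>j. (r i ^ (a' + b')) ^ j / (real j)\<^sup>2 / (2 * real a' * real b')) sums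
      integral\<^sup>L unit_lborel (\<lambda>t. circle_log (r i) a t * circle_log (r i) b t)"
      unfolding ab by (rule integral_circle_log_mult_circle_log_sums) (use r pos ab in auto)
    from sums_mult2[OF this, of "2 * real a' * real b'"] pos
    have "(\<lambda>j. (r i ^ (a' + b')) ^ j / (real j)\<^sup>2) sums
      (integral\<^sup>L unit_lborel (\<lambda>t. circle_log (r i) a t * circle_log (r i) b t) * (2 * real a' * real b'))"
      by simp
    then show ?thesis using pos by (simp add: sums_iff)
  qed
  \<comment> \<open>The gcd enters through a' b' = a b / g^2.\<close>
  moreover have "pi\<^sup>2 / 6 / (2 * real a' * real b') = pi\<^sup>2 / 12 * ((real (gcd a b))\<^sup>2 / (real a * real b))"
    unfolding g_def[symmetric] using pos by (simp add: ab(1,2) power2_eq_square)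
  ultimately show ?thesis by simp
qed

section \<open>Passing to the limit under the integral\<close>

text \<open>The exceptional points are of the form n/k with n an integer, so they are countable and
  hence null.\<close>

lemma AE_cis_neq_1:
  assumes "k > 0"
  shows "AE t in unit_lborel. cis (2 * pi * real k * t) \<noteq> 1"
proof -
  have "{t. cis (2 * pi * real k * t) = 1} \<subseteq> range (\<lambda>n::int. of_int n / real k)"
  proof
    fix t assume "t \<in> {t. cis (2 * pi * real k * t) = 1}"
    then have "cos (2 * pi * real k * t) = 1" by (simp add: complex_eq_iff)
    then obtain n :: int where "2 * pi * real k * t = of_int n * 2 * pi"
      by (auto simp: cos_one_2pi_int)
    then have "t = of_int n / real k" using assms by (simp add: field_simps)
    then show "t \<in> range (\<lambda>n::int. of_int n / real k)" by blast
  qed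
  then have "countable {t. cis (2 * pi * real k * t) = 1}"
    by (rule countable_subset) auto
  then have "AE t in lborel. t \<notin> {t. cis (2 * pi * real k * t) = 1}"
    by (intro AE_not_in countable_imp_null_set_lborel)
  then show ?thesis by (simp add: AE_restrict_space_iff) (erule AE_mp, auto)
qed

lemma tendsto_circle_log:
  assumes "cis (2 * pi * real k * t) \<noteq> 1" and "r \<longlonglongrightarrow> 1"
  shows "(\<lambda>i. circle_log (r i) k t) \<longlonglongrightarrow> circle_log 1 k t"
  unfolding circle_log_def using assms
  by (intro tendsto_intros) auto

text \<open>A majorant independent of r. For |z| = 1 one has |r z - z| = 1 - r <= |1 - r z|, so the
  triangle inequality gives |1 - z| <= 2 |1 - r z|. Taking logarithms costs only
  \<open>ln 2\<close>.\<close>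

lemma abs_circle_log_le:
  assumes "cis (2 * pi * real k * t) \<noteq> 1" and "0 \<le> r" "r < 1"
  shows "\<bar>circle_log r k t\<bar> \<le> ln 2 + \<bar>circle_log 1 k t\<bar>"
proof -
  define z where "z = cis (2 * pi * real k * t)"
  have z: "cmod z = 1" "z \<noteq> 1" using assms by (auto simp: z_def)
  have rz: "cmod (complex_of_real r * z) = r" "cmod (complex_of_real r * z - z) = 1 - r"
  proof -
    have "complex_of_real r * z - z = complex_of_real (r - 1) * z" by (simp add: algebra_simps)
    then show "cmod (complex_of_real r * z - z) = 1 - r"
      using z assms by (simp only: norm_mult norm_of_real) simp
  qed (use z assms in \<open>simp add: norm_mult\<close>)
  have "1 - r \<le> cmod (1 - r * z)" "cmod (1 - r * z) \<le> 2"
    using norm_triangle_ineq2[of 1 "r * z"] norm_triangle_ineq4[of 1 "r * z"] rz assms by auto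
  moreover have "cmod (1 - z) \<le> cmod (1 - r * z) + cmod (r * z - z)"
    using norm_triangle_ineq[of "1 - r * z" "r * z - z"] by simp
  ultimately have *: "cmod (1 - z) / 2 \<le> cmod (1 - r * z)" "cmod (1 - r * z) \<le> 2"
    using rz by auto
  have "0 < cmod (1 - z)" using z by auto
  then have "ln (cmod (1 - z) / 2) \<le> ln (cmod (1 - r * z))" "ln (cmod (1 - r * z)) \<le> ln 2"
    using * assms by (auto intro!: ln_mono simp del: ln_le_cancel_iff)
  then show ?thesis
    using \<open>0 < cmod (1 - z)\<close> by (auto simp: circle_log_def z_def ln_div)
qed

lemma ex_tendsto_1_from_below:
  obtains r :: "nat \<Rightarrow> real" where "\<And>i. 0 \<le> r i" "\<And>i. r i < 1" "r \<longlonglongrightarrow> 1"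
proof
  show "(\<lambda>i. real i / real (Suc i)) \<longlonglongrightarrow> 1" by (rule LIMSEQ_n_over_Suc_n)
qed auto

text \<open>With a = b = k the second moments tend to pi^2/12, and Fatou carries this bound to r =
  1. Dominated convergence is not yet available, since its majorant rests on this lemma.\<close>

lemma integrable_circle_log_square:
  assumes "k > 0"
  shows "integrable unit_lborel (\<lambda>t. (circle_log 1 k t)\<^sup>2)"
proof -
  obtain r :: "nat \<Rightarrow> real" where r: "\<And>i. 0 \<le> r i" "\<And>i. r i < 1" "r \<longlonglongrightarrow> 1"
    by (rule ex_tendsto_1_from_below) blast
  define I where "I i = integral\<^sup>L unit_lborel (\<lambda>t. (circle_log (r i) k t)\<^sup>2)" for i
  have "I \<longlonglongrightarrow> pi\<^sup>2 / 12"
    using tendsto_integral_circle_log_mult_circle_log[OF assms assms r] assms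
    by (simp add: I_def[abs_def] power2_eq_square)
  then have lim: "(\<lambda>i. ennreal (I i)) \<longlonglongrightarrow> ennreal (pi\<^sup>2 / 12)"
    by (rule tendsto_ennrealI)
  have int: "integrable unit_lborel (\<lambda>t. (circle_log (r i) k t)\<^sup>2)" for i
    using circle_log_bounds[of "r i" k] r
    by (intro integrable_unit_lborel_bounded[of _ "(ln 2 - ln (1 - r i))\<^sup>2"])
       (auto simp: abs_le_square_iff[symmetric] intro: order_trans[OF _ abs_ge_self])
  have meas: "(\<lambda>t. (circle_log s k t)\<^sup>2) \<in> borel_measurable unit_lborel" for s
    by (intro borel_measurable_unit_lborel) measurable
  \<comment> \<open>Off the null set the square is a limit, hence a liminf, which is the form that
    Fatou takes.\<close>
  have "(\<integral>\<^sup>+ t. ennreal ((circle_log 1 k t)\<^sup>2) \<partial>unit_lborel) =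
      (\<integral>\<^sup>+ t. liminf (\<lambda>i. ennreal ((circle_log (r i) k t)\<^sup>2)) \<partial>unit_lborel)"
  proof (rule nn_integral_cong_AE)
    show "AE t in unit_lborel. ennreal ((circle_log 1 k t)\<^sup>2) =
      liminf (\<lambda>i. ennreal ((circle_log (r i) k t)\<^sup>2))"
      using AE_cis_neq_1[OF assms]
    proof eventually_elim
      case (elim t)
      have "(\<lambda>i. ennreal ((circle_log (r i) k t)\<^sup>2)) \<longlonglongrightarrow> ennreal ((circle_log 1 k t)\<^sup>2)"
        by (intro tendsto_ennrealI tendsto_power tendsto_circle_log elim r)
      then show ?case by (intro lim_imp_Liminf[symmetric]) simp_all
    qed
  qed
  also have "\<dots> \<le> liminf (\<lambda>i. \<integral>\<^sup>+ t. ennreal ((circle_log (r i) k t)\<^sup>2) \<partial>unit_lborel)"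
    using meas by (intro nn_integral_liminf) auto
  also have "\<dots> = liminf (\<lambda>i. ennreal (I i))"
    unfolding I_def using int by (subst nn_integral_eq_integral) auto
  also have "\<dots> = ennreal (pi\<^sup>2 / 12)"
    using lim by (intro lim_imp_Liminf) simp_all
  also have "\<dots> < \<infinity>" by simp
  finally show ?thesis
    using meas by (intro integrableI_bounded) auto
qed

lemma integral_circle_log_mult_circle_log:
  assumes "a > 0" "b > 0"
  shows "integral\<^sup>L unit_lborel (\<lambda>t. circle_log 1 a t * circle_log 1 b t) =
    pi\<^sup>2 / 12 * ((real (gcd a b))\<^sup>2 / (real a * real b))"
proof -
  obtain r :: "nat \<Rightarrow> real" where r: "\<And>i. 0 \<le> r i" "\<And>i. r i < 1" "r \<longlonglongrightarrow> 1"
    by (rule ex_tendsto_1_from_below) blast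
  \<comment> \<open>Expanding (ln 2 + x)(ln 2 + y), the product of the two majorants, gives cross
    terms. They are bounded by squares, so that square integrability suffices.\<close>
  define w where "w t = 4 * (ln 2)\<^sup>2 + 2 * (circle_log 1 a t)\<^sup>2 + 2 * (circle_log 1 b t)\<^sup>2" for t
  have "(\<lambda>i. integral\<^sup>L unit_lborel (\<lambda>t. circle_log (r i) a t * circle_log (r i) b t))
    \<longlonglongrightarrow> integral\<^sup>L unit_lborel (\<lambda>t. circle_log 1 a t * circle_log 1 b t)"
  proof (rule integral_dominated_convergence)
    show "(\<lambda>t. circle_log s a t * circle_log s b t) \<in> borel_measurable unit_lborel" for s
      by (intro borel_measurable_unit_lborel) measurable
    then show "(\<lambda>t. circle_log (r i) a t * circle_log (r i) b t) \<in> borel_measurable unit_lborel" for i .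
    show "integrable unit_lborel w"
      unfolding w_def
      by (intro Bochner_Integration.integrable_add integrable_mult_right integrable_circle_log_square
          assms integrable_unit_lborel_bounded[of _ "4 * (ln 2)\<^sup>2"]) auto
    show "AE t in unit_lborel. (\<lambda>i. circle_log (r i) a t * circle_log (r i) b t)
        \<longlonglongrightarrow> circle_log 1 a t * circle_log 1 b t"
      using AE_cis_neq_1[OF assms(1)] AE_cis_neq_1[OF assms(2)]
      by eventually_elim (intro tendsto_mult tendsto_circle_log r)
    show "AE t in unit_lborel. norm (circle_log (r i) a t * circle_log (r i) b t) \<le> w t" for i
      using AE_cis_neq_1[OF assms(1)] AE_cis_neq_1[OF assms(2)]
    proof eventually_elim
      case (elim t)
      let ?x = "\<bar>circle_log 1 a t\<bar>" and ?y = "\<bar>circle_log 1 b t\<bar>"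
      have "norm (circle_log (r i) a t * circle_log (r i) b t) \<le> (ln 2 + ?x) * (ln 2 + ?y)"
        unfolding real_norm_def abs_mult
        using elim r by (intro mult_mono abs_circle_log_le) auto
      also have "\<dots> \<le> 4 * (ln 2)\<^sup>2 + 2 * ?x\<^sup>2 + 2 * ?y\<^sup>2"
      proof -
        \<comment> \<open>The three half squares absorb the cross terms u x, u y and x y; the
          remaining squares are slack.\<close>
        have "4 * u\<^sup>2 + 2 * x\<^sup>2 + 2 * y\<^sup>2 - (u + x) * (u + y) =
            (u - x)\<^sup>2 / 2 + (u - y)\<^sup>2 / 2 + (x - y)\<^sup>2 / 2 + 2 * u\<^sup>2 + x\<^sup>2 + y\<^sup>2" for u x y :: real
          by (simp add: power2_eq_square field_simps)
        moreover have "0 \<le> (u - x)\<^sup>2 / 2 + (u - y)\<^sup>2 / 2 + (x - y)\<^sup>2 / 2 + 2 * u\<^sup>2 + x\<^sup>2 + y\<^sup>2" for u x y :: real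
          by (intro add_nonneg_nonneg) auto
        ultimately show ?thesis by (metis diff_ge_0_iff_ge)
      qed
      finally show ?case by (simp add: w_def)
    qed
  qed
  then show ?thesis
    using tendsto_integral_circle_log_mult_circle_log[OF assms r] by (rule LIMSEQ_unique)
qed

theorem theorem9:
  fixes a b :: nat
  assumes "a > 0" and "b > 0"
  shows "mahler2 (monom 1 a - 1) (monom 1 b - 1) =
    pi\<^sup>2 / 12 * ((real (gcd a b))\<^sup>2 / (real a * real b))"
proof -
  \<comment> \<open>This holds at every t, roots included, because |z^k - 1| = |1 - z^k| and both
    sides use the same value of \<open>ln 0\<close>.\<close>
  have "ln (cmod (poly (monom 1 k - 1) (exp (2 * complex_of_real pi * \<i> * complex_of_real t)))) =
      circle_log 1 k t" for k t
  proof -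
    have "exp (2 * complex_of_real pi * \<i> * complex_of_real t) = cis (2 * pi * t)"
      by (simp add: cis_conv_exp mult_ac)
    then show ?thesis
      by (simp add: poly_monom circle_log_def Complex.DeMoivre norm_minus_commute mult_ac)
  qed
  then show ?thesis
    using integral_circle_log_mult_circle_log[OF assms]
    by (simp add: mahler2_def set_lebesgue_integral_def integral_restrict_space)
qed

end
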